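(* Let $(Y,d)$ be a pseudo-metric space and let $\precsim$ be a preorder on $Y$. Then the function $d^2_\precsim: Y\times Y\to\mathbb{R}^{+}$ defined by $$d^2_\precsim(x,y)=\begin{cases} \dfrac{d(x,y)}{2}, & x\precsim y,\\[2mm] \dfrac12+\dfrac{d(x,y)}{2}, & \text{otherwise,}\end{cases}$$ is a quasi-pseudo-metric such that $\tau_{d^2_\precsim}$ is finer than $\tau_A^{\precsim}$. Therefore, $\precsim$ is lower $\tau_{d^2_\precsim}$-continuous. If $d$ is a metric on $Y$, then $d^2_\precsim$ is a $T_1$ quasi-metric.
   Context: $\mathbb{R}^+=[0,\infty)$. A preorder is a reflexive transitive relation. A quasi-pseudo-metric on a non-empty set $Y$ is a function $q:Y\times Y\to\mathbb{R}^+$ with $q(x,x)=0$ and $q(x,z)\le q(x,y)+q(y,z)$; it induces the topology $\tau_q$ with base the balls $B_q(x,\varepsilon)=\{y\in Y: q(x,y)<\varepsilon\}$, $\varepsilon>0$. A quasi-metric is a quasi-pseudo-metric with $q(x,y)=q(y,x)=0\Leftrightarrow x=y$; it is $T_1$ if moreover $q(x,y)=0\Leftrightarrow x=y$. The Alexandroff topology $\tau_A^{\precsim}$ consists of all up-sets of $\precsim$, i.e. sets $G\subseteq Y$ such that $x\in G$ and $x\precsim y$ imply $y\in G$. $\precsim$ is lower $\tau$-continuous if $\{x\in Y: x\precsim y\}$ is $\tau$-closed for every $y\in Y$. "$\tau$ finer than $\tau'$" means $\tau'\subseteq\tau$. *)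

theory Defs
  imports "HOL-Analysis.Analysis"
begin

text \<open>
  Distances are total functions on the ambient type, of which only the restriction to
  \<open>Y \<times> Y\<close> is relevant.  In contrast to the locale \<open>Metric_space\<close>, nothing is required
  off \<open>Y\<close>; the two notions are related by \<open>metric_on_iff_Metric_space\<close> below.
\<close>

definition quasi_pseudo_metric_on :: "'a set \<Rightarrow> ('a \<Rightarrow> 'a \<Rightarrow> real) \<Rightarrow> bool" where
  "quasi_pseudo_metric_on Y q \<longleftrightarrow>
     Y \<noteq> {} \<and>
     (\<forall>x\<in>Y. \<forall>y\<in>Y. 0 \<le> q x y) \<and>
     (\<forall>x\<in>Y. q x x = 0) \<and>
     (\<forall>x\<in>Y. \<forall>y\<in>Y. \<forall>z\<in>Y. q x z \<le> q x y + q y z)"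

definition quasi_metric_on :: "'a set \<Rightarrow> ('a \<Rightarrow> 'a \<Rightarrow> real) \<Rightarrow> bool" where
  "quasi_metric_on Y q \<longleftrightarrow>
     quasi_pseudo_metric_on Y q \<and>
     (\<forall>x\<in>Y. \<forall>y\<in>Y. q x y = 0 \<and> q y x = 0 \<longleftrightarrow> x = y)"

definition T1_quasi_metric_on :: "'a set \<Rightarrow> ('a \<Rightarrow> 'a \<Rightarrow> real) \<Rightarrow> bool" where
  "T1_quasi_metric_on Y q \<longleftrightarrow>
     quasi_metric_on Y q \<and> (\<forall>x\<in>Y. \<forall>y\<in>Y. q x y = 0 \<longleftrightarrow> x = y)"

definition pseudo_metric_on :: "'a set \<Rightarrow> ('a \<Rightarrow> 'a \<Rightarrow> real) \<Rightarrow> bool" where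
  "pseudo_metric_on Y d \<longleftrightarrow>
     quasi_pseudo_metric_on Y d \<and> (\<forall>x\<in>Y. \<forall>y\<in>Y. d x y = d y x)"

definition metric_on :: "'a set \<Rightarrow> ('a \<Rightarrow> 'a \<Rightarrow> real) \<Rightarrow> bool" where
  "metric_on Y d \<longleftrightarrow>
     pseudo_metric_on Y d \<and> (\<forall>x\<in>Y. \<forall>y\<in>Y. d x y = 0 \<longleftrightarrow> x = y)"

lemma metric_on_iff_Metric_space:
  "metric_on Y d \<longleftrightarrow>
     Y \<noteq> {} \<and> Metric_space Y (\<lambda>x y. if x \<in> Y \<and> y \<in> Y then d x y else 0)"
  unfolding metric_on_def pseudo_metric_on_def quasi_pseudo_metric_on_def Metric_space_def
  by (auto 0 3; metis)

definition qball :: "'a set \<Rightarrow> ('a \<Rightarrow> 'a \<Rightarrow> real) \<Rightarrow> 'a \<Rightarrow> real \<Rightarrow> 'a set" where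
  "qball Y q x e = {y \<in> Y. q x y < e}"

text \<open>The open sets are the arbitrary unions of balls.\<close>

definition qtopology :: "'a set \<Rightarrow> ('a \<Rightarrow> 'a \<Rightarrow> real) \<Rightarrow> 'a topology" where
  "qtopology Y q =
     topology (arbitrary union_of (\<lambda>B. \<exists>x\<in>Y. \<exists>e>0. B = qball Y q x e))"

lemma union_of_qballs_iff:
  assumes "quasi_pseudo_metric_on Y q"
  shows "(arbitrary union_of (\<lambda>B. \<exists>x\<in>Y. \<exists>e>0. B = qball Y q x e)) U \<longleftrightarrow>
         U \<subseteq> Y \<and> (\<forall>x\<in>U. \<exists>e>0. qball Y q x e \<subseteq> U)" (is "?L U \<longleftrightarrow> ?R U")
proof
  assume "?L U"
  then obtain \<B> where \<B>: "\<And>B. B \<in> \<B> \<Longrightarrow> \<exists>x\<in>Y. \<exists>e>0. B = qball Y q x e" and U: "U = \<Union>\<B>"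
    by (auto simp: union_of_def)
  have "\<exists>e>0. qball Y q y e \<subseteq> U" if "y \<in> U" for y
  proof -
    from that U obtain B where B: "B \<in> \<B>" "y \<in> B" by blast
    then obtain x e where x: "x \<in> Y" "B = qball Y q x e" using \<B> by blast
    with B have y: "y \<in> Y" "q x y < e" by (auto simp: qball_def)
    have "qball Y q y (e - q x y) \<subseteq> B"
    proof
      fix z assume z: "z \<in> qball Y q y (e - q x y)"
      then have "q x z \<le> q x y + q y z"
        using assms x y by (simp add: qball_def quasi_pseudo_metric_on_def)
      with z x show "z \<in> B" by (simp add: qball_def)
    qed
    moreover have "B \<subseteq> U" using B U by blast
    ultimately show ?thesis using y by (intro exI[of _ "e - q x y"]) auto
  qed
  moreover have "U \<subseteq> Y" using \<B> U by (fastforce simp: qball_def)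
  ultimately show "?R U" by blast
next
  assume R: "?R U"
  have "\<exists>B. (\<exists>x\<in>Y. \<exists>e>0. B = qball Y q x e) \<and> x \<in> B \<and> B \<subseteq> U" if x: "x \<in> U" for x
  proof -
    from R x obtain e where e: "e > 0" "qball Y q x e \<subseteq> U" and xY: "x \<in> Y" by blast
    then have "x \<in> qball Y q x e"
      using assms by (simp add: qball_def quasi_pseudo_metric_on_def)
    with e xY show ?thesis by blast
  qed
  then show "?L U" by (simp add: arbitrary_union_of_alt)
qed

lemma openin_qtopology:
  assumes "quasi_pseudo_metric_on Y q"
  shows "openin (qtopology Y q) U \<longleftrightarrow> U \<subseteq> Y \<and> (\<forall>x\<in>U. \<exists>e>0. qball Y q x e \<subseteq> U)"
proof -
  have "istopology (\<lambda>U. U \<subseteq> Y \<and> (\<forall>x\<in>U. \<exists>e>0. qball Y q x e \<subseteq> U))"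
    unfolding istopology_def
  proof (intro conjI allI impI)
    fix S T
    assume S: "S \<subseteq> Y \<and> (\<forall>x\<in>S. \<exists>e>0. qball Y q x e \<subseteq> S)"
      and T: "T \<subseteq> Y \<and> (\<forall>x\<in>T. \<exists>e>0. qball Y q x e \<subseteq> T)"
    show "S \<inter> T \<subseteq> Y" using S by blast
    show "\<forall>x\<in>S \<inter> T. \<exists>e>0. qball Y q x e \<subseteq> S \<inter> T"
    proof
      fix x assume "x \<in> S \<inter> T"
      then obtain e e' where "e > 0" "qball Y q x e \<subseteq> S" "e' > 0" "qball Y q x e' \<subseteq> T"
        using S T by blast
      then show "\<exists>e>0. qball Y q x e \<subseteq> S \<inter> T"
        by (intro exI[of _ "min e e'"]) (auto simp: qball_def)
    qed
  qed (blast, meson Union_upper UnionE order_trans)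
  then show ?thesis
    unfolding qtopology_def union_of_qballs_iff[OF assms, abs_def]
    by (simp add: topology_inverse')
qed

lemma topspace_qtopology:
  assumes "quasi_pseudo_metric_on Y q"
  shows "topspace (qtopology Y q) = Y"
proof -
  have "openin (qtopology Y q) Y"
    unfolding openin_qtopology[OF assms] by (auto simp: qball_def intro: exI[of _ 1])
  then show ?thesis
    by (metis assms openin_qtopology openin_subset openin_topspace subset_antisym)
qed

definition alexandroff_topology :: "'a set \<Rightarrow> 'a rel \<Rightarrow> 'a topology" where
  "alexandroff_topology Y r =
     topology (\<lambda>G. G \<subseteq> Y \<and> (\<forall>x\<in>G. \<forall>y\<in>Y. (x, y) \<in> r \<longrightarrow> y \<in> G))"

lemma openin_alexandroff_topology:
  "openin (alexandroff_topology Y r) G \<longleftrightarrow>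
     G \<subseteq> Y \<and> (\<forall>x\<in>G. \<forall>y\<in>Y. (x, y) \<in> r \<longrightarrow> y \<in> G)"
proof -
  have "istopology (\<lambda>G. G \<subseteq> Y \<and> (\<forall>x\<in>G. \<forall>y\<in>Y. (x, y) \<in> r \<longrightarrow> y \<in> G))"
    unfolding istopology_def by blast
  then show ?thesis
    by (simp add: alexandroff_topology_def topology_inverse')
qed

lemma topspace_alexandroff_topology: "topspace (alexandroff_topology Y r) = Y"
  by (metis (no_types, lifting) openin_alexandroff_topology openin_subset openin_topspace
      order_refl subset_antisym)

definition finer_topology :: "'a topology \<Rightarrow> 'a topology \<Rightarrow> bool" where
  "finer_topology T T' \<longleftrightarrow> (\<forall>U. openin T' U \<longrightarrow> openin T U)"

definition lower_continuous :: "'a set \<Rightarrow> 'a rel \<Rightarrow> 'a topology \<Rightarrow> bool" where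
  "lower_continuous Y r T \<longleftrightarrow> (\<forall>y\<in>Y. closedin T {x \<in> Y. (x, y) \<in> r})"

definition d2 :: "'a rel \<Rightarrow> ('a \<Rightarrow> 'a \<Rightarrow> real) \<Rightarrow> 'a \<Rightarrow> 'a \<Rightarrow> real" where
  "d2 r d x y = (if (x, y) \<in> r then d x y / 2 else 1 / 2 + d x y / 2)"

end

theory Submission
  imports Defs
begin

text \<open>
  The penalty \<open>1/2\<close> respects the triangle inequality because, by transitivity, two
  unpenalised steps compose to an unpenalised step.  The ball of radius \<open>1/2\<close> about \<open>x\<close>
  lies in the up-set of \<open>x\<close>, so every up-set is open; the complement of a set
  \<open>{x. x \<precsim> y}\<close> is an up-set.
\<close>

lemma quasi_pseudo_metric_on_d2:
  assumes d: "quasi_pseudo_metric_on Y d" and r: "preorder_on Y r"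
  shows "quasi_pseudo_metric_on Y (d2 r d)"
  unfolding quasi_pseudo_metric_on_def
proof (intro conjI ballI)
  show "Y \<noteq> {}" using d by (simp add: quasi_pseudo_metric_on_def)
next
  fix x y assume "x \<in> Y" "y \<in> Y"
  then show "0 \<le> d2 r d x y" using d by (simp add: quasi_pseudo_metric_on_def d2_def)
next
  fix x assume "x \<in> Y"
  then show "d2 r d x x = 0"
    using d r by (auto simp: quasi_pseudo_metric_on_def d2_def preorder_on_def dest: refl_onD)
next
  fix x y z assume "x \<in> Y" "y \<in> Y" "z \<in> Y"
  then have "d x z \<le> d x y + d y z" using d by (simp add: quasi_pseudo_metric_on_def)
  moreover have "(x, y) \<in> r \<Longrightarrow> (y, z) \<in> r \<Longrightarrow> (x, z) \<in> r"
    using r by (auto simp: preorder_on_def dest: transD)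
  ultimately show "d2 r d x z \<le> d2 r d x y + d2 r d y z"
    \<comment> \<open>If the left side carries the summand \<open>1 / 2\<close>, transitivity puts
      \<open>(x, y)\<close> or \<open>(y, z)\<close> outside \<open>r\<close>, so the right side
      carries it too.\<close>
    by (auto simp: d2_def field_simps)
qed

text \<open>Since \<open>d\<close> is nonnegative on \<open>Y\<close>, leaving the up-set of
  \<open>x\<close> costs at least \<open>1 / 2\<close>, and the ball is defined by a strict
  inequality.\<close>

lemma qball_d2_subset_upset:
  assumes "quasi_pseudo_metric_on Y d" "x \<in> Y"
  shows "qball Y (d2 r d) x (1 / 2) \<subseteq> {y \<in> Y. (x, y) \<in> r}"
proof
  fix y assume y: "y \<in> qball Y (d2 r d) x (1 / 2)"
  then have "0 \<le> d x y" using assms by (simp add: qball_def quasi_pseudo_metric_on_def)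
  then show "y \<in> {y \<in> Y. (x, y) \<in> r}" using y by (simp add: qball_def d2_def split: if_splits)
qed

lemma finer_topology_d2_alexandroff:
  assumes d: "quasi_pseudo_metric_on Y d" and r: "preorder_on Y r"
  shows "finer_topology (qtopology Y (d2 r d)) (alexandroff_topology Y r)"
  unfolding finer_topology_def
proof (intro allI impI)
  fix U assume "openin (alexandroff_topology Y r) U"
  then have U: "U \<subseteq> Y" "\<And>x y. x \<in> U \<Longrightarrow> y \<in> Y \<Longrightarrow> (x, y) \<in> r \<Longrightarrow> y \<in> U"
    by (auto simp: openin_alexandroff_topology)
  have "qball Y (d2 r d) x (1 / 2) \<subseteq> U" if "x \<in> U" for x
    using qball_d2_subset_upset[OF d, of x r] U that by blast
  then show "openin (qtopology Y (d2 r d)) U"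
    unfolding openin_qtopology[OF quasi_pseudo_metric_on_d2[OF d r]]
    \<comment> \<open>The same radius \<open>1 / 2\<close> serves every point of \<open>U\<close>;
      the cited rules only supply its positivity.\<close>
    using U(1) by (meson half_gt_zero_iff zero_less_one)
qed

text \<open>The complement in \<open>Y\<close> is an up-set: if \<open>(x, z)\<close> and
  \<open>(z, y)\<close> lie in \<open>r\<close>, so does \<open>(x, y)\<close>; hence leaving the
  set below \<open>y\<close> upwards is irreversible.\<close>

lemma lower_continuous_if_finer_alexandroff:
  assumes r: "trans r" and T: "topspace T = Y" "finer_topology T (alexandroff_topology Y r)"
  shows "lower_continuous Y r T"
  unfolding lower_continuous_def
proof
  fix y
  have "openin (alexandroff_topology Y r) (Y - {x \<in> Y. (x, y) \<in> r})"
    using r by (auto simp: openin_alexandroff_topology dest: transD)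
  then show "closedin T {x \<in> Y. (x, y) \<in> r}"
    using T by (auto simp: closedin_def finer_topology_def)
qed

lemma T1_quasi_metric_on_d2:
  assumes d: "metric_on Y d" and r: "preorder_on Y r"
  shows "T1_quasi_metric_on Y (d2 r d)"
proof -
  have q: "quasi_pseudo_metric_on Y d"
    using d by (simp add: metric_on_def pseudo_metric_on_def)
  have "d2 r d x y = 0 \<longleftrightarrow> x = y" if xy: "x \<in> Y" "y \<in> Y" for x y
  proof
    assume 0: "d2 r d x y = 0"
    have "0 \<le> d x y" using q xy by (simp add: quasi_pseudo_metric_on_def)
    \<comment> \<open>A penalised value is at least \<open>1 / 2\<close>, so only the branch
      \<open>d x y / 2 = 0\<close> survives.\<close>
    with 0 have "d x y = 0" by (simp add: d2_def split: if_splits)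
    then show "x = y" using d xy by (simp add: metric_on_def)
  next
    assume "x = y"
    then show "d2 r d x y = 0"
      using quasi_pseudo_metric_on_d2[OF q r] xy by (simp add: quasi_pseudo_metric_on_def)
  qed
  then show ?thesis
    \<comment> \<open>The two-sided separation axiom of a quasi-metric follows from the one-sided
      equivalence, applied to both orders of the points.\<close>
    using quasi_pseudo_metric_on_d2[OF q r]
    by (auto simp: T1_quasi_metric_on_def quasi_metric_on_def)
qed

theorem theorem23:
  fixes Y :: "'a set" and d :: "'a \<Rightarrow> 'a \<Rightarrow> real" and r :: "'a rel"
  assumes "pseudo_metric_on Y d"
    and "preorder_on Y r"
  shows "quasi_pseudo_metric_on Y (d2 r d)
    \<and> finer_topology (qtopology Y (d2 r d)) (alexandroff_topology Y r)
    \<and> lower_continuous Y r (qtopology Y (d2 r d))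
    \<and> (metric_on Y d \<longrightarrow> T1_quasi_metric_on Y (d2 r d))"
proof -
  have d: "quasi_pseudo_metric_on Y d" using assms(1) by (simp add: pseudo_metric_on_def)
  note q = quasi_pseudo_metric_on_d2[OF d assms(2)]
  note f = finer_topology_d2_alexandroff[OF d assms(2)]
  have "trans r" using assms(2) by (simp add: preorder_on_def)
  then have "lower_continuous Y r (qtopology Y (d2 r d))"
    using lower_continuous_if_finer_alexandroff topspace_qtopology[OF q] f by blast
  with q f T1_quasi_metric_on_d2 assms(2) show ?thesis by blast
qed

end
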